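(* For every $x\in(0,\infty)$, there exists a unique number $a\in\bigl(\frac12,e^{-\gamma}\bigr)$ such that $\psi(x)=I_a(x)$. Conversely, for every $a\in\bigl(\frac12,e^{-\gamma}\bigr)$, there exists a unique number $x\in(0,\infty)$ such that $\psi(x)=I_a(x)$.
   Context: $\Gamma(x)=\int_0^\infty e^{-t}t^{x-1}\,dt$ for $x>0$ is Euler's gamma function, and $\psi(x)=\frac{d}{dx}\ln\Gamma(x)=\Gamma'(x)/\Gamma(x)$ for $x>0$ is the psi (digamma) function. $\gamma=0.577\ldots$ is the Euler–Mascheroni constant, so $e^{-\gamma}=0.56\ldots$. For $a\in[0,1]$ and $x>0$, $I_a(x)=\ln(x+a)-\frac1x$. *)

theory Defs
  imports "HOL-Analysis.Analysis"
begin

text \<open>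
  The psi function is the library's \<open>Digamma\<close>, which is introduced there by a series.
  On the positive reals it is the logarithmic derivative of \<open>Gamma\<close>, and \<open>Gamma\<close> is given
  by Euler's integral (library fact \<open>Gamma_integral_real\<close>).
\<close>

lemma has_real_derivative_ln_o_Gamma:
  fixes x :: real
  assumes "x > 0"
  shows "((\<lambda>t. ln (Gamma t)) has_real_derivative Digamma x) (at x)"
proof (rule DERIV_cong_ev[THEN iffD1])
  show "(ln_Gamma has_real_derivative Digamma x) (at x)"
    using assms by (rule has_field_derivative_ln_Gamma_real)
  show "\<forall>\<^sub>F t in nhds x. ln_Gamma t = ln (Gamma t)"
    using eventually_nhds_in_open[of "{0<..}" x] assms
    by (auto elim!: eventually_mono simp: ln_Gamma_real_pos)
qed simp_all

lemma Digamma_eq_deriv_Gamma_div_Gamma: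
  fixes x :: real
  assumes "x > 0"
  shows "Digamma x = deriv Gamma x / Gamma x"
proof -
  have "(Gamma has_real_derivative Gamma x * Digamma x) (at x)"
    using assms by (intro has_field_derivative_Gamma) (auto elim!: nonpos_Ints_cases)
  then show ?thesis
    using Gamma_real_pos[OF assms] by (simp add: DERIV_imp_deriv)
qed

text \<open>Only meant for \<open>a\<close> in \<open>[0, 1]\<close> and \<open>x > 0\<close>.\<close>

definition I_fun :: "real \<Rightarrow> real \<Rightarrow> real" where
  "I_fun a x = ln (x + a) - 1 / x"

end

theory Submission
  imports Defs "HOL-Real_Asymp.Real_Asymp"
begin

text \<open>
  Write \<open>\<psi>\<close> for the digamma function. Since \<open>\<psi>(x) + 1/x = \<psi>(x + 1)\<close>, the equation
  \<open>\<psi>(x) = ln (x + a) - 1/x\<close> can be solved for \<open>a\<close>: it says that \<open>a\<close> is the number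
  \<open>d(x) = exp (\<psi>(x + 1)) - x\<close> (\<open>Digamma_eq_I_fun_iff\<close>). So the theorem says that \<open>d\<close> is a
  bijection from \<open>(0, \<infinity>)\<close> onto \<open>(1/2, e\<^sup>-\<^sup>\<gamma>)\<close>. The function is continuous on \<open>[0, \<infinity>)\<close> and
  \<open>d(0) = exp (\<psi>(1)) = e\<^sup>-\<^sup>\<gamma>\<close>, so it suffices to show that \<open>d\<close> tends to \<open>1/2\<close>
  (\<open>tendsto_digamma_offset\<close>) and decreases strictly (\<open>digamma_offset_strict_antimono\<close>).

  The main point is the monotonicity, which amounts to \<open>exp (\<psi>(y)) \<psi>'(y) < 1\<close> for \<open>y \<ge> 1\<close>
  (\<open>exp_Digamma_mult_trigamma_less_1\<close>). This and the other sharp estimates of \<open>\<psi>\<close> and \<open>\<psi>'\<close> come from one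
  device: a function that tends to 0 at infinity and decreases along every unit step is
  nonnegative. It suits \<open>\<psi>\<close> and \<open>\<psi>'\<close> because their unit steps \<open>1/y\<close> and \<open>-1/y\<^sup>2\<close> are
  elementary. For \<open>h = ln \<psi>' + \<psi>\<close>, which has to be negative, the unit step is positive if
  \<open>\<psi>'(y) (1 - exp (-1/y)) > 1/y\<^sup>2\<close>; and this follows from
  \<open>\<psi>'(y) > 1/y + 1/(2 y\<^sup>2) + 1/(12 y\<^sup>3)\<close>, obtained by the same device, together with a
  Pade bound on the exponential function.
\<close>

section \<open>Telescoping along unit steps\<close>

lemma nonneg_if_unit_step_decreasing_to_0:
  fixes f :: "real \<Rightarrow> real"
  assumes lim: "(f \<longlongrightarrow> 0) at_top"
    and step: "\<And>t. t \<ge> y \<Longrightarrow> f (t + 1) \<le> f t"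
  shows "f y \<ge> 0"
proof -
  have "filterlim (\<lambda>n. y + real n) at_top sequentially"
    by real_asymp
  with lim have "(\<lambda>n. f (y + real n)) \<longlonglongrightarrow> 0"
    by (rule filterlim_compose)
  moreover have "decseq (\<lambda>n. f (y + real n))"
    using step[of "y + real n" for n] by (intro decseq_SucI) (simp add: add_ac)
  ultimately have "f (y + real 0) \<ge> 0"
    by (intro decseq_ge)
  thus ?thesis by simp
qed

lemma pos_if_unit_step_strictly_decreasing_to_0:
  fixes f :: "real \<Rightarrow> real"
  assumes lim: "(f \<longlongrightarrow> 0) at_top"
    and step: "\<And>t. t \<ge> y \<Longrightarrow> f (t + 1) < f t"
  shows "f y > 0"
proof -
  have "f (y + 1) \<ge> 0"
    using lim step by (intro nonneg_if_unit_step_decreasing_to_0) (auto intro: less_imp_le)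
  with step[of y] show ?thesis by simp
qed

section \<open>First-order bounds for the digamma and trigamma functions\<close>

text \<open>
  By the mean value theorem, \<open>ln y = ln_Gamma (y + 1) - ln_Gamma y\<close> is a value of the digamma
  function between \<open>y\<close> and \<open>y + 1\<close>, and the digamma function increases.
\<close>

lemma Digamma_bounds:
  fixes y :: real
  assumes "y > 0"
  shows "ln y - 1 / y < Digamma y" "Digamma y < ln y"
proof -
  have "\<exists>z. y < z \<and> z < y + 1 \<and> ln_Gamma (y + 1) - ln_Gamma y = (y + 1 - y) * Digamma z"
    using assms by (intro MVT2) (auto intro!: has_field_derivative_ln_Gamma_real)
  then obtain z where z: "y < z" "z < y + 1" "ln_Gamma (y + 1) - ln_Gamma y = Digamma z"
    by auto
  have "Gamma (y + 1) = y * Gamma y"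
    using assms by (intro Gamma_plus1) (auto elim!: nonpos_Ints_cases)
  hence "Digamma z = ln y"
    using assms z(3) Gamma_real_pos[OF assms] by (simp add: ln_Gamma_real_pos ln_mult)
  moreover have "Digamma y < Digamma z" "Digamma z < Digamma (y + 1)"
    using assms z by (auto intro!: Digamma_real_strict_mono)
  ultimately show "ln y - 1 / y < Digamma y" "Digamma y < ln y"
    using assms Digamma_plus1[of y] by auto
qed

text \<open>
  The same argument one derivative higher: \<open>1 / y\<close> is the unit step of the digamma function, hence
  a value of its decreasing derivative between \<open>y\<close> and \<open>y + 1\<close>.
\<close>

lemma trigamma_bounds:
  fixes y :: real
  assumes "y > 0"
  shows "1 / y < Polygamma 1 y" "Polygamma 1 (y + 1) < 1 / y"
proof -
  have "\<exists>z. y < z \<and> z < y + 1 \<and> Digamma (y + 1) - Digamma y = (y + 1 - y) * Polygamma 1 z"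
    using assms
    by (intro MVT2) (auto intro!: derivative_eq_intros elim!: nonpos_Ints_cases)
  then obtain z where z: "y < z" "z < y + 1" "Digamma (y + 1) - Digamma y = Polygamma 1 z"
    by auto
  have "Polygamma 1 z = 1 / y"
    using z(3) assms Digamma_plus1[of y] by simp
  moreover have "Polygamma 1 z < Polygamma 1 y" "Polygamma 1 (y + 1) < Polygamma 1 z"
    using assms z by (auto intro!: Polygamma_real_strict_antimono)
  ultimately show "1 / y < Polygamma 1 y" "Polygamma 1 (y + 1) < 1 / y"
    by auto
qed

lemma trigamma_pos:
  fixes y :: real
  assumes "y > 0"
  shows "Polygamma 1 y > 0"
  using assms by (intro Polygamma_real_odd_pos) (auto elim!: nonpos_Ints_cases)

lemma trigamma_upper_bound:
  fixes y :: real
  assumes "y > 1"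
  shows "Polygamma 1 y < 1 / (y - 1)"
  using trigamma_bounds(2)[of "y - 1"] assms by simp

lemma trigamma_plus1:
  fixes y :: real
  assumes "y > 0"
  shows "Polygamma 1 (y + 1) = Polygamma 1 y - 1 / y\<^sup>2"
  using assms Polygamma_plus1[of y 1] by (simp add: numeral_2_eq_2)

lemma tendsto_Digamma_minus_ln: "((\<lambda>y. Digamma y - ln y) \<longlongrightarrow> (0::real)) at_top"
proof (rule tendsto_sandwich)
  show "\<forall>\<^sub>F y in at_top. - 1 / y \<le> Digamma y - ln (y::real)"
    using eventually_gt_at_top[of 0]
  proof eventually_elim
    case (elim y) thus ?case using Digamma_bounds(1)[of y] by simp
  qed
  show "\<forall>\<^sub>F y in at_top. Digamma y - ln (y::real) \<le> 0"
    using eventually_gt_at_top[of 0]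
  proof eventually_elim
    case (elim y) thus ?case using Digamma_bounds(2)[of y] by simp
  qed
qed real_asymp+

section \<open>The derivative of the exponential of the digamma function\<close>

text \<open>
  The asymptotic expansion of the trigamma function starts with \<open>1/y + 1/(2 y\<^sup>2) + 1/(6 y\<^sup>3)\<close>.
  The coefficient \<open>1/12\<close> leaves room in the unit step and is exactly
  what is needed to match the Pade denominator in \<open>exp_minus_le_Pade\<close>.
\<close>

lemma trigamma_lower_bound:
  fixes y :: real
  assumes "y \<ge> 1"
  shows "Polygamma 1 y > 1 / y + 1 / (2 * y\<^sup>2) + 1 / (12 * y ^ 3)"
proof -
  let ?F = "\<lambda>t::real. 1 / t + 1 / (2 * t\<^sup>2) + 1 / (12 * t ^ 3)"
  have "Polygamma 1 y - ?F y > 0"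
  proof (rule pos_if_unit_step_strictly_decreasing_to_0
      [where y = y and f = "\<lambda>t. Polygamma 1 t - ?F t"])
    show "((\<lambda>t. Polygamma 1 t - ?F t) \<longlongrightarrow> 0) at_top"
    proof (rule tendsto_sandwich)
      show "\<forall>\<^sub>F t in at_top. 1 / t - ?F t \<le> Polygamma 1 t - ?F t"
        using eventually_gt_at_top[of 0]
      proof eventually_elim
        case (elim t) thus ?case using trigamma_bounds(1)[of t] by simp
      qed
      show "\<forall>\<^sub>F t in at_top. Polygamma 1 t - ?F t \<le> 1 / (t - 1) - ?F t"
        using eventually_gt_at_top[of 1]
      proof eventually_elim
        case (elim t) thus ?case using trigamma_upper_bound[of t] by simp
      qed
    qed real_asymp+
  next
    fix t :: real assume "t \<ge> y"
    hence t: "t \<ge> 1" using assms by simp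
    define s where "s = t + 1"
    have s_nz: "s \<noteq> 0" using t by (simp add: s_def)
    have "?F s + 1 / t\<^sup>2 - ?F t =
        (12 * t ^ 3 * s\<^sup>2 + 6 * t ^ 3 * s + t ^ 3 + 12 * t * s ^ 3
          - 12 * t\<^sup>2 * s ^ 3 - 6 * t * s ^ 3 - s ^ 3) / (12 * t ^ 3 * s ^ 3)"
      using t s_nz by (simp add: field_simps power2_eq_square power3_eq_cube)
    also have "12 * t ^ 3 * s\<^sup>2 + 6 * t ^ 3 * s + t ^ 3 + 12 * t * s ^ 3
        - 12 * t\<^sup>2 * s ^ 3 - 6 * t * s ^ 3 - s ^ 3 = 3 * t\<^sup>2 + 3 * t - 1"
      unfolding s_def by algebra
    also have "(3 * t\<^sup>2 + 3 * t - 1) / (12 * t ^ 3 * s ^ 3) > 0"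
    proof (rule divide_pos_pos)
      have "t\<^sup>2 > 0" using t by simp
      thus "3 * t\<^sup>2 + 3 * t - 1 > 0" using t by linarith
    qed (use t in \<open>simp add: s_def\<close>)
    finally show "Polygamma 1 (t + 1) - ?F (t + 1) < Polygamma 1 t - ?F t"
      using t trigamma_plus1[of t] by (simp add: s_def)
  qed
  thus ?thesis by simp
qed

text \<open>
  The right-hand side is the \<open>[2/2]\<close> Pade approximant
  \<open>(12 - 6u + u\<^sup>2) / (12 + 6u + u\<^sup>2)\<close> of \<open>exp (- u)\<close>. The difference of the logarithms has a
  derivative in which all terms but \<open>u\<^sup>4\<close> cancel from the numerator.
\<close>

lemma exp_minus_le_Pade:
  fixes u :: real
  assumes "u \<ge> 0"
  shows "exp (- u) \<le> 1 - 12 * u / (12 + 6 * u + u\<^sup>2)"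
proof -
  define p q where "p = (\<lambda>u::real. 12 + 6 * u + u\<^sup>2)" and "q = (\<lambda>u::real. 12 - 6 * u + u\<^sup>2)"
  have p_pos: "p u > 0" and q_pos: "q u > 0" for u
  proof -
    have "p u = (u + 3)\<^sup>2 + 3" "q u = (u - 3)\<^sup>2 + 3"
      by (simp_all add: p_def q_def power2_eq_square algebra_simps)
    thus "p u > 0" "q u > 0" by (simp_all add: add_nonneg_pos)
  qed
  let ?f = "\<lambda>u. u - ln (p u) + ln (q u)"
  have "?f 0 \<le> ?f u"
  proof (rule DERIV_nonneg_imp_nondecreasing[OF assms])
    fix t :: real
    have p': "(p has_real_derivative 6 + 2 * t) (at t)"
      and q': "(q has_real_derivative - 6 + 2 * t) (at t)"
      unfolding p_def q_def by (auto intro!: derivative_eq_intros)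
    have "(?f has_real_derivative 1 - (6 + 2 * t) / p t + (- 6 + 2 * t) / q t) (at t)"
      using p_pos[of t] q_pos[of t]
      by (auto intro!: derivative_eq_intros p' q' simp: divide_inverse)
    moreover have "1 - (6 + 2 * t) / p t + (- 6 + 2 * t) / q t = t ^ 4 / (p t * q t)"
    proof -
      have "p t * q t - (6 + 2 * t) * q t + (- 6 + 2 * t) * p t = t ^ 4"
        by (simp add: p_def q_def algebra_simps power2_eq_square power4_eq_xxxx)
      thus ?thesis using p_pos[of t] q_pos[of t] by (simp add: field_simps)
    qed
    moreover have "t ^ 4 / (p t * q t) \<ge> 0"
      using p_pos[of t] q_pos[of t] by simp
    ultimately show "\<exists>d. (?f has_real_derivative d) (at t) \<and> 0 \<le> d" by auto
  qed
  hence "- u \<le> ln (q u / p u)"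
    using p_pos[of u] q_pos[of u] by (simp add: ln_div p_def q_def)
  hence "exp (- u) \<le> q u / p u"
    using p_pos[of u] q_pos[of u] by (metis divide_pos_pos exp_le_cancel_iff exp_ln)
  also have "\<dots> = 1 - 12 * u / p u"
    using p_pos[of u] by (simp add: field_simps) (simp add: p_def q_def)
  finally show ?thesis by (simp add: p_def)
qed

text \<open>
  With \<open>u = 1 / y\<close>, the bound in \<open>trigamma_lower_bound\<close> is \<open>u (12 + 6u + u\<^sup>2) / 12\<close>, and
  \<open>1 - exp (- u) \<ge> 12 u / (12 + 6u + u\<^sup>2)\<close>. The product of the two bounds is \<open>u\<^sup>2\<close>, the
  amount by which the trigamma function drops in a unit step.
\<close>

lemma trigamma_mult_exp_neg_less:
  fixes y :: real
  assumes "y \<ge> 1"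
  shows "Polygamma 1 y * exp (- (1 / y)) < Polygamma 1 (y + 1)"
proof -
  define u p where "u = 1 / y" and "p = 12 + 6 * u + u\<^sup>2"
  have u: "u > 0" using assms by (simp add: u_def)
  have p: "p > 0" using u by (simp add: p_def add_pos_pos)
  have "u * p / 12 < Polygamma 1 y"
    using trigamma_lower_bound[OF assms] assms
    by (simp add: p_def u_def field_simps power2_eq_square power3_eq_cube)
  hence "u * p / 12 * (12 * u / p) < Polygamma 1 y * (12 * u / p)"
    using u p by (intro mult_strict_right_mono) auto
  also have "\<dots> \<le> Polygamma 1 y * (1 - exp (- u))"
    using exp_minus_le_Pade[of u] u trigamma_pos[of y] assms
    by (intro mult_left_mono) (auto simp: p_def)
  finally have "u\<^sup>2 < Polygamma 1 y * (1 - exp (- u))"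
    using p by (simp add: power2_eq_square)
  thus ?thesis
    using trigamma_plus1[of y] assms by (simp add: u_def algebra_simps power_divide)
qed

lemma tendsto_ln_trigamma_plus_Digamma:
  "((\<lambda>y. ln (Polygamma 1 y) + Digamma y) \<longlongrightarrow> (0::real)) at_top"
proof -
  have "((\<lambda>y. ln (Polygamma 1 y) + ln y) \<longlongrightarrow> (0::real)) at_top"
  proof (rule tendsto_sandwich)
    show "\<forall>\<^sub>F y in at_top. 0 \<le> ln (Polygamma 1 y) + ln (y::real)"
      using eventually_gt_at_top[of 0]
    proof eventually_elim
      case (elim y)
      have "ln (1 / y) \<le> ln (Polygamma 1 y)"
        using trigamma_bounds(1)[of y] elim by (intro ln_mono) auto
      thus ?case using elim by (simp add: ln_div)
    qed
    show "\<forall>\<^sub>F y in at_top. ln (Polygamma 1 y) + ln (y::real) \<le> ln (1 / (y - 1)) + ln y"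
      using eventually_gt_at_top[of 1]
    proof eventually_elim
      case (elim y)
      have "ln (Polygamma 1 y) \<le> ln (1 / (y - 1))"
        using trigamma_upper_bound[of y] trigamma_pos[of y] elim by (intro ln_mono) auto
      thus ?case by simp
    qed
  qed real_asymp+
  from tendsto_add[OF this tendsto_Digamma_minus_ln] show ?thesis by simp
qed

text \<open>
  The logarithm of the left-hand side vanishes at infinity and, by \<open>trigamma_mult_exp_neg_less\<close>,
  increases along unit steps, so it is negative.
\<close>

lemma exp_Digamma_mult_trigamma_less_1:
  fixes y :: real
  assumes "y \<ge> 1"
  shows "exp (Digamma y) * Polygamma 1 y < 1"
proof -
  have pos: "Polygamma 1 t > 0" if "t \<ge> 1" for t :: real
    using trigamma_pos[of t] that by simp
  have "- (ln (Polygamma 1 y) + Digamma y) > 0"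
  proof (rule pos_if_unit_step_strictly_decreasing_to_0
      [where y = y and f = "\<lambda>t. - (ln (Polygamma 1 t) + Digamma t)"])
    show "((\<lambda>t. - (ln (Polygamma 1 t) + Digamma t)) \<longlongrightarrow> (0::real)) at_top"
      using tendsto_minus[OF tendsto_ln_trigamma_plus_Digamma] by simp
  next
    fix t :: real assume "t \<ge> y"
    hence t: "t \<ge> 1" using assms by simp
    have "ln (Polygamma 1 t * exp (- (1 / t))) < ln (Polygamma 1 (t + 1))"
      using pos[of t] pos[of "t + 1"] t trigamma_mult_exp_neg_less[OF t] by simp
    hence "ln (Polygamma 1 t) - 1 / t < ln (Polygamma 1 (t + 1))"
      using pos[OF t] by (simp add: ln_mult)
    thus "- (ln (Polygamma 1 (t + 1)) + Digamma (t + 1)) < - (ln (Polygamma 1 t) + Digamma t)"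
      using t Digamma_plus1[of t] by simp
  qed
  hence "exp (ln (Polygamma 1 y) + Digamma y) < 1" by simp
  thus ?thesis using pos[OF assms] by (simp add: exp_add mult.commute)
qed

section \<open>The second-order behaviour of the digamma function\<close>

text \<open>
  The unit step of \<open>ln (y - 1/2)\<close> is the integral of \<open>1/t\<close> over an interval with midpoint \<open>y\<close>,
  which is at least \<open>1/y\<close> by convexity.
\<close>

lemma ln_minus_half_le_Digamma:
  fixes y :: real
  assumes "y > 1 / 2"
  shows "ln (y - 1 / 2) \<le> Digamma y"
proof -
  have "Digamma y - ln (y - 1 / 2) \<ge> 0"
  proof (rule nonneg_if_unit_step_decreasing_to_0
      [where y = y and f = "\<lambda>t. Digamma t - ln (t - 1 / 2)"])
    have "((\<lambda>t. ln t - ln (t - 1 / 2)) \<longlongrightarrow> (0::real)) at_top" by real_asymp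
    from tendsto_add[OF tendsto_Digamma_minus_ln this]
    show "((\<lambda>t. Digamma t - ln (t - 1 / 2)) \<longlongrightarrow> (0::real)) at_top" by simp
  next
    fix t :: real assume "t \<ge> y"
    hence t: "t > 1 / 2" using assms by simp
    have "1 / t \<le> ln (t + 1 / 2) - ln (t - 1 / 2)"
      using ln_inverse_approx_ge[of "t - 1 / 2" "t + 1 / 2"] t by simp
    moreover have "t + 1 - 1 / 2 = t + 1 / 2" by simp
    moreover have "Digamma (t + 1) = Digamma t + 1 / t"
      using t by (intro Digamma_plus1) auto
    ultimately show "Digamma (t + 1) - ln (t + 1 - 1 / 2) \<le> Digamma t - ln (t - 1 / 2)"
      by (simp add: add_ac)
  qed
  thus ?thesis by simp
qed

text \<open>
  Here the trapezoidal rule overestimates the integral of \<open>1/t\<close> over \<open>[y, y + 1]\<close>.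
\<close>

lemma Digamma_le_ln_minus:
  fixes y :: real
  assumes "y > 0"
  shows "Digamma y \<le> ln y - 1 / (2 * y)"
proof -
  have "ln y - 1 / (2 * y) - Digamma y \<ge> 0"
  proof (rule nonneg_if_unit_step_decreasing_to_0
      [where y = y and f = "\<lambda>t. ln t - 1 / (2 * t) - Digamma t"])
    have "((\<lambda>t. - 1 / (2 * t)) \<longlongrightarrow> (0::real)) at_top" by real_asymp
    from tendsto_diff[OF this tendsto_Digamma_minus_ln]
    have "((\<lambda>t. - 1 / (2 * t) - (Digamma t - ln t)) \<longlongrightarrow> (0::real)) at_top"
      by simp
    thus "((\<lambda>t. ln t - 1 / (2 * t) - Digamma t) \<longlongrightarrow> (0::real)) at_top"
      by (rule Lim_transform_eventually) (auto intro!: always_eventually)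
  next
    fix t :: real assume "t \<ge> y"
    hence t: "t > 0" using assms by simp
    define p q where "p = 1 / (2 * t)" and "q = 1 / (2 * (t + 1))"
    have "inverse t = 2 * p" "inverse (t + 1) = 2 * q"
      using t by (simp_all add: p_def q_def divide_simps)
    hence "ln (t + 1) - ln t \<le> p + q" "Digamma (t + 1) = Digamma t + 2 * p"
      using ln_inverse_approx_le[of t 1] Digamma_plus1[of t] t by (simp_all add: inverse_eq_divide)
    thus "ln (t + 1) - 1 / (2 * (t + 1)) - Digamma (t + 1) \<le> ln t - 1 / (2 * t) - Digamma t"
      unfolding p_def [symmetric] q_def [symmetric] by linarith
  qed
  thus ?thesis by simp
qed

section \<open>The solution of the equation for the offset\<close>

definition digamma_offset :: "real \<Rightarrow> real" where
  "digamma_offset x = exp (Digamma (x + 1)) - x"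

lemma Digamma_eq_I_fun_iff:
  assumes "x > 0" "a > 0"
  shows "Digamma x = I_fun a x \<longleftrightarrow> a = digamma_offset x"
proof -
  have "Digamma x = I_fun a x \<longleftrightarrow> Digamma (x + 1) = ln (x + a)"
    using assms Digamma_plus1[of x] by (auto simp: I_fun_def)
  also have "\<dots> \<longleftrightarrow> exp (Digamma (x + 1)) = x + a"
    using assms by (metis add_pos_pos exp_ln ln_exp)
  also have "\<dots> \<longleftrightarrow> a = digamma_offset x"
    by (auto simp: digamma_offset_def)
  finally show ?thesis .
qed

lemma has_derivative_digamma_offset:
  assumes "x \<ge> 0"
  shows "(digamma_offset has_real_derivative exp (Digamma (x + 1)) * Polygamma 1 (x + 1) - 1) (at x)"
  unfolding digamma_offset_def [abs_def] using assms
  by (auto intro!: derivative_eq_intros elim!: nonpos_Ints_cases)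

lemma digamma_offset_strict_antimono:
  assumes "0 \<le> x" "x < y"
  shows "digamma_offset y < digamma_offset x"
proof (rule DERIV_neg_imp_decreasing[OF assms(2)])
  fix t assume "x \<le> t"
  hence t: "t \<ge> 0" using assms by simp
  have "exp (Digamma (t + 1)) * Polygamma 1 (t + 1) - 1 < 0"
    using exp_Digamma_mult_trigamma_less_1[of "t + 1"] t by simp
  with has_derivative_digamma_offset[OF t]
  show "\<exists>d. (digamma_offset has_real_derivative d) (at t) \<and> d < 0"
    by blast
qed

text \<open>
  The lower bound on the digamma function gives \<open>1/2\<close> directly. The upper bound gives
  \<open>y exp (- 1 / (2 y)) - y + 1\<close> at \<open>y = x + 1\<close>, which tends to \<open>1 - 1/2\<close>.
\<close>

lemma tendsto_digamma_offset: "(digamma_offset \<longlongrightarrow> 1 / 2) at_top"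
proof (rule tendsto_sandwich)
  show "\<forall>\<^sub>F x in at_top. 1 / 2 \<le> digamma_offset x"
    using eventually_gt_at_top[of 0]
  proof eventually_elim
    case (elim x)
    have "ln (x + 1 / 2) \<le> Digamma (x + 1)"
      using ln_minus_half_le_Digamma[of "x + 1"] elim by (simp add: add_ac)
    hence "exp (ln (x + 1 / 2)) \<le> exp (Digamma (x + 1))" by (simp only: exp_le_cancel_iff)
    hence "x + 1 / 2 \<le> exp (Digamma (x + 1))" using elim by simp
    thus ?case by (simp add: digamma_offset_def)
  qed
  show "\<forall>\<^sub>F x in at_top. digamma_offset x \<le> exp (ln (x + 1) - 1 / (2 * (x + 1))) - x"
    using eventually_gt_at_top[of 0]
  proof eventually_elim
    case (elim x)
    thus ?case using Digamma_le_ln_minus[of "x + 1"] by (simp add: digamma_offset_def)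
  qed
qed real_asymp+

lemma digamma_offset_bounds:
  assumes "x > 0"
  shows "digamma_offset x \<in> {1 / 2<..<exp (- euler_mascheroni)}"
proof -
  have "digamma_offset x < exp (- euler_mascheroni)"
    using digamma_offset_strict_antimono[of 0 x] assms by (simp add: digamma_offset_def)
  \<comment> \<open>The limit bounds values only weakly; comparing \<open>x\<close> with \<open>x + 1\<close> makes it strict.\<close>
  moreover have "1 / 2 \<le> digamma_offset (x + 1)"
  proof (rule tendsto_upperbound[OF tendsto_digamma_offset])
    show "\<forall>\<^sub>F t in at_top. digamma_offset t \<le> digamma_offset (x + 1)"
      using eventually_gt_at_top[of "x + 1"]
    proof eventually_elim
      case (elim t) thus ?case using digamma_offset_strict_antimono[of "x + 1" t] assms by simp
    qed
  qed simp
  moreover have "digamma_offset (x + 1) < digamma_offset x"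
    using assms by (intro digamma_offset_strict_antimono) auto
  ultimately show ?thesis by simp
qed

lemma digamma_offset_surj:
  assumes "a \<in> {1 / 2<..<exp (- euler_mascheroni)}"
  obtains x where "x > 0" "digamma_offset x = a"
proof -
  have "\<forall>\<^sub>F t in at_top. digamma_offset t < a \<and> t > 0"
    using assms
    by (intro eventually_conj order_tendstoD(2)[OF tendsto_digamma_offset] eventually_gt_at_top) auto
  then obtain b where b: "digamma_offset b < a" "b > 0"
    by (auto dest!: eventually_happens)
  have "\<exists>x\<ge>0. x \<le> b \<and> digamma_offset x = a"
  proof (rule IVT2)
    show "a \<le> digamma_offset 0" using assms by (simp add: digamma_offset_def)
    show "\<forall>x. 0 \<le> x \<and> x \<le> b \<longrightarrow> isCont digamma_offset x"
      using has_derivative_digamma_offset DERIV_isCont by blast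
  qed (use b in auto)
  then obtain x where x: "x \<ge> 0" "digamma_offset x = a" by auto
  moreover have "x \<noteq> 0" using x assms by (auto simp: digamma_offset_def)
  ultimately show ?thesis using that[of x] by simp
qed

theorem theorem3:
  shows "(\<forall>x::real. x \<in> {0<..} \<longrightarrow>
            (\<exists>!a::real. a \<in> {1/2<..<exp (- euler_mascheroni)} \<and> Digamma x = I_fun a x))
       \<and> (\<forall>a::real. a \<in> {1/2<..<exp (- euler_mascheroni)} \<longrightarrow>
            (\<exists>!x::real. x \<in> {0<..} \<and> Digamma x = I_fun a x))"
proof (intro conjI allI impI)
  fix x :: real assume "x \<in> {0<..}"
  hence x: "x > 0" by simp
  show "\<exists>!a. a \<in> {1/2<..<exp (- euler_mascheroni)} \<and> Digamma x = I_fun a x"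
  proof (rule ex1I[of _ "digamma_offset x"])
    show "digamma_offset x \<in> {1/2<..<exp (- euler_mascheroni)} \<and>
        Digamma x = I_fun (digamma_offset x) x"
      using digamma_offset_bounds[OF x] Digamma_eq_I_fun_iff[OF x, of "digamma_offset x"] by auto
  next
    fix a assume "a \<in> {1/2<..<exp (- euler_mascheroni)} \<and> Digamma x = I_fun a x"
    thus "a = digamma_offset x"
      using Digamma_eq_I_fun_iff[OF x, of a] by simp
  qed
next
  fix a :: real assume a: "a \<in> {1/2<..<exp (- euler_mascheroni)}"
  hence a_pos: "a > 0" by simp
  obtain x where x: "x > 0" "digamma_offset x = a"
    using digamma_offset_surj[OF a] .
  show "\<exists>!x. x \<in> {0<..} \<and> Digamma x = I_fun a x"
  proof (rule ex1I[of _ x])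
    show "x \<in> {0<..} \<and> Digamma x = I_fun a x"
      using x Digamma_eq_I_fun_iff[OF x(1) a_pos] by simp
  next
    fix y assume "y \<in> {0<..} \<and> Digamma y = I_fun a y"
    hence "y > 0" "digamma_offset y = digamma_offset x"
      using Digamma_eq_I_fun_iff[of y a] a_pos x by auto
    thus "y = x"
      using digamma_offset_strict_antimono[of x y] digamma_offset_strict_antimono[of y x] x
      by (cases y x rule: linorder_cases) auto
  qed
qed

end
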